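(* For all total functions $g:\{0,1\}^m \to \{0,1\}$, (1) $\mathsf{RS}(g)=O(\mathsf{R}^{\mathsf{prod}}(g))$, and (2) $\mathsf{RS}(g)=\Omega(\mathsf{R}^{\mathsf{prod}}(g) / \log \mathsf{R}^{\mathsf{prod}}(g))$.
   Context: A deterministic decision tree on $m$ variables adaptively queries variables of $x\in\{0,1\}^m$; each leaf $\ell$ corresponds to the subcube $\ell\subseteq\{0,1\}^m$ of inputs reaching it. A randomized decision tree is a probability distribution over deterministic decision trees (leaves may be unlabelled); its query complexity is the maximum depth of a tree in its support. A product distribution $\mu$ on $\{0,1\}^m$ is one under which the bits are independent; $\mathsf{PROD}$ is the set of them. For a tree $T$ and $\mu$, let $p^\mu_\ell$ be the probability that $T$ on $x\sim\mu$ reaches leaf $\ell$, and $\mathbf{p}^\mu=(p^\mu_\ell)_\ell$; $\mu|_\ell$ is $\mu$ conditioned on $x\in\ell$. A randomized decision tree $\mathcal{R}$ computes $g$ with error $\epsilon$ for product distributions if for every $\mu\in\mathsf{PROD}$, $\mathbf{E}_{T\sim\mathcal{R}}\mathbf{E}_{\ell\sim\mathbf{p}^\mu}[\min\{\Pr_{x\sim\mu|_\ell}[g(x)=0],\Pr_{x\sim\mu|_\ell}[g(x)=1]\}]\le\epsilon$ (the min taken as $0$ when $p^\mu_\ell=0$). $\mathsf{R}^{\mathsf{prod}}_\epsilon(g)$ is the minimum query complexity of such $\mathcal{R}$, and $\mathsf{R}^{\mathsf{prod}}(g):=\mathsf{R}^{\mathsf{prod}}_{1/3}(g)$. The sabotage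 complexity $\mathsf{RS}_\epsilon(g)$ is the minimum query complexity of a randomized decision tree $\mathcal{R}$ such that for every $x\in g^{-1}(0)$, $y\in g^{-1}(1)$, with probability at least $1-\epsilon$ a tree $T\sim\mathcal{R}$ run on $x$ queries some index $i$ with $x_i\ne y_i$; $\mathsf{RS}(g):=\mathsf{RS}_{1/3}(g)$. *)

theory Defs
  imports "HOL-Probability.Probability"
begin

text \<open>
  The dimension \<open>m\<close> must be quantified inside the statement (the asymptotic constants are uniform
  in it), so a point of \<open>{0,1}^m\<close> is a function \<open>nat \<Rightarrow> bool\<close> that is \<open>False\<close> from index \<open>m\<close> on.
  A function on the cube is an arbitrary \<open>g :: (nat \<Rightarrow> bool) \<Rightarrow> bool\<close>, of which only the values on
  \<open>cube m\<close> matter.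
\<close>

definition cube :: "nat \<Rightarrow> (nat \<Rightarrow> bool) set" where
  "cube m = {x. \<forall>i\<ge>m. \<not> x i}"

text \<open>In \<open>Query i t0 t1\<close> the computation continues with \<open>t1\<close> if \<open>x i\<close> holds and with \<open>t0\<close> otherwise.\<close>

datatype dtree = Leaf | Query nat dtree dtree

fun vars :: "dtree \<Rightarrow> nat set" where
  "vars Leaf = {}"
| "vars (Query i t0 t1) = insert i (vars t0 \<union> vars t1)"

fun depth :: "dtree \<Rightarrow> nat" where
  "depth Leaf = 0"
| "depth (Query i t0 t1) = Suc (max (depth t0) (depth t1))"

text \<open>A leaf is named by the list of queries and answers on the branch leading to it.\<close>

type_synonym leaf = "(nat \<times> bool) list"

fun leaf_of :: "dtree \<Rightarrow> (nat \<Rightarrow> bool) \<Rightarrow> leaf" where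
  "leaf_of Leaf x = []"
| "leaf_of (Query i t0 t1) x = (i, x i) # leaf_of (if x i then t1 else t0) x"

definition queried :: "dtree \<Rightarrow> (nat \<Rightarrow> bool) \<Rightarrow> nat set" where
  "queried T x = fst ` set (leaf_of T x)"

definition subcube :: "nat \<Rightarrow> dtree \<Rightarrow> leaf \<Rightarrow> (nat \<Rightarrow> bool) set" where
  "subcube m T l = {x \<in> cube m. leaf_of T x = l}"

text \<open>Randomized decision trees on \<open>m\<close> variables of query complexity at most \<open>d\<close>.\<close>

definition rdtrees :: "nat \<Rightarrow> nat \<Rightarrow> dtree pmf set" where
  "rdtrees m d = {R. \<forall>T\<in>set_pmf R. vars T \<subseteq> {..<m} \<and> depth T \<le> d}"

definition prod_dists :: "nat \<Rightarrow> (nat \<Rightarrow> bool) pmf set" where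
  "prod_dists m = {\<mu>. set_pmf \<mu> \<subseteq> cube m \<and>
     prob_space.indep_vars (measure_pmf \<mu>) (\<lambda>_. count_space UNIV) (\<lambda>i x. x i) {..<m}}"

text \<open>
  Under \<open>map_pmf (leaf_of T) \<mu>\<close> a leaf has probability \<open>p^\<mu>_l\<close>. Leaves with \<open>p^\<mu>_l = 0\<close>,
  where \<open>cond_pmf\<close> is meaningless, lie outside its support and contribute nothing.
\<close>

definition leaf_error :: "nat \<Rightarrow> ((nat \<Rightarrow> bool) \<Rightarrow> bool) \<Rightarrow> (nat \<Rightarrow> bool) pmf \<Rightarrow> dtree \<Rightarrow> leaf \<Rightarrow> real" where
  "leaf_error m g \<mu> T l =
     min (measure_pmf.prob (cond_pmf \<mu> (subcube m T l)) {x. \<not> g x})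
         (measure_pmf.prob (cond_pmf \<mu> (subcube m T l)) {x. g x})"

definition computes_prod :: "real \<Rightarrow> nat \<Rightarrow> ((nat \<Rightarrow> bool) \<Rightarrow> bool) \<Rightarrow> dtree pmf \<Rightarrow> bool" where
  "computes_prod \<epsilon> m g R \<longleftrightarrow>
     (\<forall>\<mu>\<in>prod_dists m.
        measure_pmf.expectation R
          (\<lambda>T. measure_pmf.expectation (map_pmf (leaf_of T) \<mu>) (leaf_error m g \<mu> T)) \<le> \<epsilon>)"

definition sabotages :: "real \<Rightarrow> nat \<Rightarrow> ((nat \<Rightarrow> bool) \<Rightarrow> bool) \<Rightarrow> dtree pmf \<Rightarrow> bool" where
  "sabotages \<epsilon> m g R \<longleftrightarrow>
     (\<forall>x\<in>cube m. \<forall>y\<in>cube m. \<not> g x \<longrightarrow> g y \<longrightarrow>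
        measure_pmf.prob R {T. \<exists>i\<in>queried T x. x i \<noteq> y i} \<ge> 1 - \<epsilon>)"

definition Rprod_err :: "real \<Rightarrow> nat \<Rightarrow> ((nat \<Rightarrow> bool) \<Rightarrow> bool) \<Rightarrow> nat" where
  "Rprod_err \<epsilon> m g = (LEAST d. \<exists>R\<in>rdtrees m d. computes_prod \<epsilon> m g R)"

definition RS_err :: "real \<Rightarrow> nat \<Rightarrow> ((nat \<Rightarrow> bool) \<Rightarrow> bool) \<Rightarrow> nat" where
  "RS_err \<epsilon> m g = (LEAST d. \<exists>R\<in>rdtrees m d. sabotages \<epsilon> m g R)"

definition Rprod :: "nat \<Rightarrow> ((nat \<Rightarrow> bool) \<Rightarrow> bool) \<Rightarrow> nat" where
  "Rprod = Rprod_err (1/3)"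

definition RS :: "nat \<Rightarrow> ((nat \<Rightarrow> bool) \<Rightarrow> bool) \<Rightarrow> nat" where
  "RS = RS_err (1/3)"

lemma cube_eq_iff:
  assumes "x \<in> cube m" "y \<in> cube m"
  shows "x = y \<longleftrightarrow> (\<forall>i<m. x i = y i)"
proof -
  have "x i = y i" if "\<forall>i<m. x i = y i" for i
    using that assms by (cases "i < m") (auto simp: cube_def)
  then show ?thesis by blast
qed

lemma prod_dists_eq_Pi_pmf: "prod_dists m = range (Pi_pmf {..<m} False)"
proof (intro equalityI subsetI)
  fix \<mu> assume "\<mu> \<in> prod_dists m"
  then have sub: "set_pmf \<mu> \<subseteq> cube m"
    and ind: "prob_space.indep_vars (measure_pmf \<mu>) (\<lambda>_. count_space UNIV) (\<lambda>i x. x i) {..<m}"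
    by (auto simp: prod_dists_def)
  have "\<mu> = Pi_pmf {..<m} False (\<lambda>i. map_pmf (\<lambda>x. x i) \<mu>)"
  proof (rule pmf_eqI)
    fix x
    show "pmf \<mu> x = pmf (Pi_pmf {..<m} False (\<lambda>i. map_pmf (\<lambda>x. x i) \<mu>)) x"
    proof (cases "x \<in> cube m")
      case False
      then have "pmf \<mu> x = 0" using sub by (auto simp: set_pmf_iff)
      then show ?thesis using False by (subst pmf_Pi) (auto simp: cube_def not_less)
    next
      case True
      have "pmf \<mu> x = measure_pmf.prob \<mu> {x}" by (simp add: measure_pmf_single)
      also have "\<dots> = measure_pmf.prob \<mu> (\<Inter>i\<in>{..<m}. (\<lambda>y. y i) -` {x i})"
      proof (rule measure_pmf.finite_measure_eq_AE)
        have "y = x \<longleftrightarrow> (\<forall>i<m. y i = x i)" if "y \<in> set_pmf \<mu>" for y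
          using that sub True by (intro cube_eq_iff) auto
        then show "AE y in measure_pmf \<mu>. y \<in> {x} \<longleftrightarrow> y \<in> (\<Inter>i\<in>{..<m}. (\<lambda>y. y i) -` {x i})"
          by (auto simp: AE_measure_pmf_iff)
      qed simp_all
      also have "\<dots> = (\<Prod>i<m. measure_pmf.prob \<mu> ((\<lambda>y. y i) -` {x i}))"
      proof (cases "m = 0")
        case False
        then show ?thesis
          using prob_space.indep_varsD_finite[OF prob_space_measure_pmf ind, of "\<lambda>i. {x i}"] by auto
      qed simp
      also have "\<dots> = (\<Prod>i<m. pmf (map_pmf (\<lambda>x. x i) \<mu>) (x i))"
        by (simp add: pmf_map)
      also have "\<dots> = pmf (Pi_pmf {..<m} False (\<lambda>i. map_pmf (\<lambda>x. x i) \<mu>)) x"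
        using True by (subst pmf_Pi) (auto simp: cube_def not_less)
      finally show ?thesis .
    qed
  qed
  then show "\<mu> \<in> range (Pi_pmf {..<m} False)" by blast
next
  fix \<mu> :: "(nat \<Rightarrow> bool) pmf"
  assume "\<mu> \<in> range (Pi_pmf {..<m} False)"
  then obtain p where \<mu>: "\<mu> = Pi_pmf {..<m} False p" by blast
  have "set_pmf \<mu> \<subseteq> cube m"
    using set_Pi_pmf_subset[of "{..<m}" False p] by (auto simp: \<mu> cube_def not_less)
  then show "\<mu> \<in> prod_dists m"
    using indep_vars_Pi_pmf[of "{..<m}" False p] by (simp add: prod_dists_def \<mu>)
qed

text \<open>The tree that queries everything shows that the two minima are taken over nonempty sets.\<close>

fun full_tree :: "nat \<Rightarrow> dtree" where
  "full_tree 0 = Leaf"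
| "full_tree (Suc k) = Query k (full_tree k) (full_tree k)"

lemma full_tree_rdtrees: "return_pmf (full_tree m) \<in> rdtrees m m"
proof -
  have "vars (full_tree m) \<subseteq> {..<m} \<and> depth (full_tree m) \<le> m"
    by (induction m) auto
  then show ?thesis by (simp add: rdtrees_def)
qed

lemma leaf_of_full_tree: "leaf_of (full_tree m) x = map (\<lambda>i. (i, x i)) (rev [0..<m])"
  by (induction m) auto

lemma full_tree_sabotages:
  assumes "0 \<le> \<epsilon>"
  shows "sabotages \<epsilon> m g (return_pmf (full_tree m))"
  unfolding sabotages_def
proof (intro ballI impI)
  fix x y assume "x \<in> cube m" "y \<in> cube m" "\<not> g x" "g y"
  then obtain i where "i < m" "x i \<noteq> y i"
    using cube_eq_iff[of x m y] by auto
  then have "full_tree m \<in> {T. \<exists>i\<in>queried T x. x i \<noteq> y i}"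
    by (force simp: queried_def leaf_of_full_tree)
  then show "1 - \<epsilon> \<le> measure_pmf.prob (return_pmf (full_tree m)) {T. \<exists>i\<in>queried T x. x i \<noteq> y i}"
    using assms by (simp add: measure_return_pmf)
qed

lemma full_tree_computes_prod:
  assumes "0 \<le> \<epsilon>"
  shows "computes_prod \<epsilon> m g (return_pmf (full_tree m))"
  unfolding computes_prod_def
proof
  fix \<mu> assume "\<mu> \<in> prod_dists m"
  then have sub: "set_pmf \<mu> \<subseteq> cube m" by (simp add: prod_dists_def)
  have "leaf_error m g \<mu> (full_tree m) (leaf_of (full_tree m) x) = 0" if x: "x \<in> set_pmf \<mu>" for x
  proof -
    let ?S = "subcube m (full_tree m) (leaf_of (full_tree m) x)"
    have S: "?S = {x}"
    proof -
      have "y \<in> ?S \<longleftrightarrow> y = x" for y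
        using cube_eq_iff[of y m x] x sub by (auto simp: subcube_def leaf_of_full_tree)
      then show ?thesis by auto
    qed
    have ne: "set_pmf \<mu> \<inter> {x} \<noteq> {}" using x by auto
    have "set_pmf (cond_pmf \<mu> {x}) = {x}"
      using set_cond_pmf[OF ne] x by auto
    then have "cond_pmf \<mu> {x} = return_pmf x"
      by (simp add: set_pmf_subset_singleton[symmetric])
    then show ?thesis
      by (simp add: leaf_error_def S measure_return_pmf min_def indicator_def)
  qed
  then have "measure_pmf.expectation (map_pmf (leaf_of (full_tree m)) \<mu>)
      (leaf_error m g \<mu> (full_tree m)) = 0"
    by (simp add: integral_map_pmf) (rule integral_eq_zero_AE, simp add: AE_measure_pmf_iff)
  then show "measure_pmf.expectation (return_pmf (full_tree m))
      (\<lambda>T. measure_pmf.expectation (map_pmf (leaf_of T) \<mu>) (leaf_error m g \<mu> T)) \<le> \<epsilon>"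
    using assms by simp
qed

end

theory Submission
  imports Defs
begin

text \<open>
  (1) Let \<open>g\<close> differ at \<open>x\<close> and \<open>y\<close>. Changing \<open>x\<close> into \<open>y\<close> bit by bit, \<open>g\<close> flips across some edge
  of the cube, and the uniform distribution on that edge is a product distribution. A tree that does
  not separate \<open>x\<close> from \<open>y\<close> does not separate the ends of the edge and has error 1/2 there, so this
  happens with probability at most 2/3. Three repetitions suffice.

  (2) Repeat a sabotage tree until it has depth \<open>D\<close> and error \<open>\<delta>\<close> with \<open>4 D \<delta> \<le> 1/3\<close>; this costs a
  factor logarithmic in the depth. For independent \<open>x, z \<sim> \<mu>\<close>, the input \<open>y\<close> that equals \<open>x\<close> on the
  queried coordinates and \<open>z\<close> elsewhere is distributed as \<open>\<mu>\<close> conditioned on the leaf of \<open>x\<close>, so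
  the error is at most the probability of \<open>g x \<noteq> g y\<close>. Colour the coordinates uniformly with
  \<open>K = 2 D\<close> colours and pass from \<open>x\<close> to \<open>y\<close> one colour class at a time. Each step resamples a
  random 1/K-fraction of the unqueried coordinates; with probability at least 1/2 that colour misses
  the queried coordinates, and then the step is a pair chosen independently of the tree which the
  tree fails to separate. So \<open>g\<close> changes in a given step with probability at most \<open>2 \<delta>\<close>.
\<close>

section \<open>Finite product distributions\<close>

text \<open>Being injective, \<open>F\<close> carries point masses to point masses; the exchanges of
  coordinates between two samples below are such involutions.\<close>

lemma map_pmf_involution:
  assumes inv: "\<And>w. F (F w) = w" and pmf: "\<And>w. pmf M (F w) = pmf M w"
  shows "map_pmf F M = M"
proof (rule pmf_eqI)
  fix w
  have "inj F" using inv by (metis injI)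
  then have "pmf (map_pmf F M) (F (F w)) = pmf M (F w)" by (rule pmf_map_inj')
  then show "pmf (map_pmf F M) w = pmf M w" by (simp add: inv pmf)
qed

lemma prob_pair_pmf:
  "measure_pmf.prob (pair_pmf A B) S =
   measure_pmf.expectation A (\<lambda>a. measure_pmf.prob B {b. (a, b) \<in> S})"
proof -
  have "emeasure (measure_pmf (pair_pmf A B)) S = (\<integral>\<^sup>+w. indicator S w \<partial>pair_pmf A B)"
    by simp
  also have "\<dots> = (\<integral>\<^sup>+a. \<integral>\<^sup>+b. indicator S (a, b) \<partial>B \<partial>A)"
    by (rule nn_integral_pair_pmf')
  also have "\<dots> = (\<integral>\<^sup>+a. emeasure (measure_pmf B) {b. (a, b) \<in> S} \<partial>A)"
  proof (rule nn_integral_cong)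
    fix a
    have "(\<integral>\<^sup>+b. indicator S (a, b) \<partial>B) = (\<integral>\<^sup>+b. indicator {b. (a, b) \<in> S} b \<partial>B)"
      by (intro nn_integral_cong) (auto simp: indicator_def)
    then show "(\<integral>\<^sup>+b. indicator S (a, b) \<partial>B) = emeasure (measure_pmf B) {b. (a, b) \<in> S}"
      by simp
  qed
  also have "\<dots> = (\<integral>\<^sup>+a. ennreal (measure_pmf.prob B {b. (a, b) \<in> S}) \<partial>A)"
    by (simp add: measure_pmf.emeasure_eq_measure)
  also have "\<dots> = ennreal (measure_pmf.expectation A (\<lambda>a. measure_pmf.prob B {b. (a, b) \<in> S}))"
    by (intro nn_integral_eq_integral measure_pmf.integrable_const_bound[where B = 1]) auto
  finally show ?thesis
    by (simp add: measure_pmf.emeasure_eq_measure)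
qed

lemma prob_pair_pmf_Times:
  "measure_pmf.prob (pair_pmf A B) {(a, b). P a \<and> Q b} =
   measure_pmf.prob A {a. P a} * measure_pmf.prob B {b. Q b}"
proof -
  have "measure_pmf.prob B {b. P a \<and> Q b} = indicator {a. P a} a * measure_pmf.prob B {b. Q b}" for a
    by (auto simp: indicator_def)
  then show ?thesis by (simp add: prob_pair_pmf)
qed

text \<open>The bound \<open>B\<close> makes both sides integrable; a non-integrable function has
  Bochner integral 0, which could break monotonicity.\<close>

lemma expectation_mono_pmf:
  fixes u v :: "'a \<Rightarrow> real"
  assumes "\<And>a. a \<in> set_pmf M \<Longrightarrow> 0 \<le> u a \<and> u a \<le> v a \<and> v a \<le> B"
  shows "measure_pmf.expectation M u \<le> measure_pmf.expectation M v"
proof (rule integral_mono_AE)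
  show "integrable (measure_pmf M) u" "integrable (measure_pmf M) v"
    using assms by (force intro!: measure_pmf.integrable_const_bound[where B = B] simp: AE_measure_pmf_iff)+
qed (use assms in \<open>auto simp: AE_measure_pmf_iff\<close>)

text \<open>On each coordinate the exchange at most swaps two factors. The identity is pointwise in
  \<open>x\<close> and \<open>z\<close>, so it also applies when \<open>U\<close> is chosen
  depending on \<open>x\<close>.\<close>

lemma pmf_Pi_override_swap:
  assumes "finite A"
  shows "pmf (Pi_pmf A d p) (override_on x z U) * pmf (Pi_pmf A d p) (override_on z x U) =
         pmf (Pi_pmf A d p) x * pmf (Pi_pmf A d p) z"
proof (cases "(\<forall>i. i \<notin> A \<longrightarrow> x i = d) \<and> (\<forall>i. i \<notin> A \<longrightarrow> z i = d)")
  case True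
  have "(\<Prod>i\<in>A. pmf (p i) (override_on x z U i) * pmf (p i) (override_on z x U i)) =
        (\<Prod>i\<in>A. pmf (p i) (x i) * pmf (p i) (z i))"
    by (intro prod.cong) (auto simp: override_on_def)
  then show ?thesis
    using True assms by (simp add: pmf_Pi' override_on_def prod.distrib)
next
  case False
  \<comment> \<open>A value other than \<open>d\<close> outside \<open>A\<close> survives the
    exchange in one of the two inputs, so both sides vanish.\<close>
  then obtain i where "i \<notin> A" "x i \<noteq> d \<or> z i \<noteq> d" by blast
  then have "\<not> ((\<forall>i. i \<notin> A \<longrightarrow> override_on x z U i = d) \<and> (\<forall>i. i \<notin> A \<longrightarrow> override_on z x U i = d))"
    unfolding override_on_def by metis
  with False show ?thesis using assms by (auto simp: pmf_Pi)
qed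

lemma Pi_pmf_swap:
  assumes "finite A"
  shows "map_pmf (\<lambda>(a, b). (override_on a b U, override_on b a U))
           (pair_pmf (Pi_pmf A d p) (Pi_pmf A d p)) = pair_pmf (Pi_pmf A d p) (Pi_pmf A d p)"
  using pmf_Pi_override_swap[OF assms]
  by (intro map_pmf_involution) (auto simp: pmf_pair override_on_def fun_eq_iff)

text \<open>Test \<open>P\<close> and \<open>Q\<close> on two independent samples and exchange the
  coordinates in \<open>U\<close>: both events then concern a single sample, and the law of the pair
  is unchanged.\<close>

lemma Pi_pmf_indep:
  assumes A: "finite A"
    and P: "\<And>a b. (\<And>i. i \<in> U \<Longrightarrow> a i = b i) \<Longrightarrow> P a = P b"
    and Q: "\<And>a b. (\<And>i. i \<notin> U \<Longrightarrow> a i = b i) \<Longrightarrow> Q a = Q b"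
  shows "measure_pmf.prob (Pi_pmf A d p) {a. P a} * measure_pmf.prob (Pi_pmf A d p) {a. Q a} =
         measure_pmf.prob (Pi_pmf A d p) {a. P a \<and> Q a}"
proof -
  let ?M = "Pi_pmf A d p"
  have "P (override_on b a U) = P a" "Q (override_on b a U) = Q b" for a b
    by (rule P Q; simp add: override_on_def)+
  \<comment> \<open>The conjunct \<open>True\<close> is the event for the other sample, so that
    \<open>prob_pair_pmf_Times\<close> applies once more.\<close>
  then have "measure_pmf.prob ?M {a. P a} * measure_pmf.prob ?M {a. Q a} =
      measure_pmf.prob (map_pmf (\<lambda>(a, b). (override_on a b U, override_on b a U)) (pair_pmf ?M ?M))
        {(a, b). True \<and> P b \<and> Q b}"
    by (simp add: prob_pair_pmf_Times[symmetric] vimage_def case_prod_unfold)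
  also have "\<dots> = measure_pmf.prob (pair_pmf ?M ?M) {(a, b). True \<and> P b \<and> Q b}"
    unfolding Pi_pmf_swap[OF A] ..
  also have "\<dots> = measure_pmf.prob ?M {a. P a \<and> Q a}"
    by (subst prob_pair_pmf_Times) simp
  finally show ?thesis .
qed

section \<open>Decision trees\<close>

lemma queried_simps [simp]:
  "queried Leaf x = {}"
  "queried (Query i t0 t1) x = insert i (queried (if x i then t1 else t0) x)"
  by (simp_all add: queried_def)

text \<open>Two branches can part only at a coordinate queried on both, so the coordinates queried
  on \<open>x\<close> decide.\<close>

lemma leaf_of_eq_iff: "leaf_of T x = leaf_of T y \<longleftrightarrow> (\<forall>i\<in>queried T x. x i = y i)"
  by (induction T) auto

lemma queried_eq: "leaf_of T x = leaf_of T y \<Longrightarrow> queried T x = queried T y"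
  by (simp add: queried_def)

lemma queried_subset_vars: "queried T x \<subseteq> vars T"
  by (induction T) auto

lemma card_queried_le_depth: "card (queried T x) \<le> depth T"
proof -
  have "length (leaf_of T x) \<le> depth T" by (induction T) auto
  moreover have "card (queried T x) \<le> length (leaf_of T x)"
    unfolding queried_def by (metis card_length length_map set_map)
  ultimately show ?thesis by simp
qed

text \<open>Failure to separate is the event that multiplies over independent repetitions, and as
  equality of leaves it is visibly symmetric in the inputs.\<close>

lemma sabotages_iff:
  "sabotages \<epsilon> m g R \<longleftrightarrow>
     (\<forall>x\<in>cube m. \<forall>y\<in>cube m. \<not> g x \<longrightarrow> g y \<longrightarrow>
        measure_pmf.prob R {T. leaf_of T x = leaf_of T y} \<le> \<epsilon>)"
proof -
  have "1 - \<epsilon> \<le> measure_pmf.prob R {T. \<exists>i\<in>queried T x. x i \<noteq> y i} \<longleftrightarrow>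
      measure_pmf.prob R {T. leaf_of T x = leaf_of T y} \<le> \<epsilon>" for x y
  proof -
    have "measure_pmf.prob R {T. \<exists>i\<in>queried T x. x i \<noteq> y i} =
        1 - measure_pmf.prob R {T. leaf_of T x = leaf_of T y}"
      by (subst measure_pmf.prob_compl[symmetric])
        (auto simp: leaf_of_eq_iff intro!: arg_cong2[where f = measure])
    then show ?thesis by auto
  qed
  then show ?thesis unfolding sabotages_def by simp
qed

lemma sabotagesD:
  assumes "sabotages \<epsilon> m g R" "x \<in> cube m" "y \<in> cube m" "g x \<noteq> g y"
  shows "measure_pmf.prob R {T. leaf_of T x = leaf_of T y} \<le> \<epsilon>"
proof (cases "g x")
  case True
  then have "measure_pmf.prob R {T. leaf_of T y = leaf_of T x} \<le> \<epsilon>"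
    using assms by (auto simp: sabotages_iff)
  then show ?thesis by (simp add: eq_commute)
qed (use assms in \<open>auto simp: sabotages_iff\<close>)

lemma sabotages_mono: "sabotages \<epsilon> m g R \<Longrightarrow> \<epsilon> \<le> \<epsilon>' \<Longrightarrow> sabotages \<epsilon>' m g R"
  by (force simp: sabotages_iff)

section \<open>Concatenation and independent repetition of trees\<close>

fun seq_tree :: "dtree \<Rightarrow> dtree \<Rightarrow> dtree" where
  "seq_tree Leaf T = T"
| "seq_tree (Query i t0 t1) T = Query i (seq_tree t0 T) (seq_tree t1 T)"

lemma leaf_of_seq_tree: "leaf_of (seq_tree S T) x = leaf_of S x @ leaf_of T x"
  by (induction S) auto

lemma depth_seq_tree: "depth (seq_tree S T) \<le> depth S + depth T"
  by (induction S) auto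

lemma vars_seq_tree: "vars (seq_tree S T) \<subseteq> vars S \<union> vars T"
  by (induction S) auto

lemma leaf_of_seq_tree_eq_iff:
  "leaf_of (seq_tree S T) x = leaf_of (seq_tree S T) y \<longleftrightarrow>
     leaf_of S x = leaf_of S y \<and> leaf_of T x = leaf_of T y"
proof -
  have "queried (seq_tree S T) x = queried S x \<union> queried T x"
    by (simp add: queried_def leaf_of_seq_tree image_Un)
  then show ?thesis by (auto simp: leaf_of_eq_iff)
qed

fun repeat_tree :: "dtree pmf \<Rightarrow> nat \<Rightarrow> dtree pmf" where
  "repeat_tree R 0 = return_pmf Leaf"
| "repeat_tree R (Suc k) = map_pmf (\<lambda>(S, T). seq_tree S T) (pair_pmf R (repeat_tree R k))"

lemma repeat_tree_rdtrees:
  assumes "R \<in> rdtrees m d"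
  shows "repeat_tree R k \<in> rdtrees m (k * d)"
proof (induction k)
  case (Suc k)
  have "vars (seq_tree S T) \<subseteq> {..<m} \<and> depth (seq_tree S T) \<le> Suc k * d"
    if "S \<in> set_pmf R" "T \<in> set_pmf (repeat_tree R k)" for S T
  proof -
    have "vars S \<union> vars T \<subseteq> {..<m}" "depth S + depth T \<le> Suc k * d"
      using that Suc.IH assms by (fastforce simp: rdtrees_def)+
    then show ?thesis
      using vars_seq_tree depth_seq_tree by (meson order_trans)
  qed
  then show ?case by (auto simp: rdtrees_def)
qed (simp add: rdtrees_def)

lemma prob_repeat_tree:
  "measure_pmf.prob (repeat_tree R k) {T. leaf_of T x = leaf_of T y} =
   measure_pmf.prob R {T. leaf_of T x = leaf_of T y} ^ k"
proof (induction k)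
  case (Suc k)
  have "measure_pmf.prob (repeat_tree R (Suc k)) {T. leaf_of T x = leaf_of T y} =
      measure_pmf.prob (pair_pmf R (repeat_tree R k))
        {(S, T). leaf_of S x = leaf_of S y \<and> leaf_of T x = leaf_of T y}"
    by (simp add: vimage_def case_prod_unfold leaf_of_seq_tree_eq_iff)
  then show ?case
    by (simp only: prob_pair_pmf_Times Suc.IH power_Suc)
qed (simp add: measure_return_pmf)

lemma sabotages_repeat_tree:
  assumes "sabotages \<epsilon> m g R"
  shows "sabotages (\<epsilon> ^ k) m g (repeat_tree R k)"
  using assms by (auto simp: sabotages_iff prob_repeat_tree intro!: power_mono)

lemma leaf_error_bounds: "0 \<le> leaf_error m g \<mu> T l" "leaf_error m g \<mu> T l \<le> 1"
  by (auto simp: leaf_error_def min_le_iff_disj)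

section \<open>From product distributions to sabotage\<close>

lemma adjacent_hybrid:
  assumes "\<not> g x" "g y" "x \<in> cube m" "y \<in> cube m"
  obtains k where "k < m" "x k \<noteq> y k"
    "\<not> g (override_on x y {..<k})" "g (override_on x y {..<Suc k})"
proof -
  let ?h = "\<lambda>k. override_on x y {..<k}"
  have "?h 0 = x" by simp
  moreover have "?h m = y"
    using assms by (auto simp: override_on_def fun_eq_iff cube_def not_less)
  ultimately have "\<not> g (?h 0)" "g (?h m)" using assms by simp_all
  \<comment> \<open>If no step flipped \<open>g\<close>, its truth would descend from
    \<open>m\<close> to 0.\<close>
  then obtain k where k: "k < m" "\<not> g (?h k)" "g (?h (Suc k))"
    using inc_induct[of 0 m "\<lambda>k. g (?h k)"] by blast
  have "x k \<noteq> y k"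
  proof
    assume "x k = y k"
    then have "?h (Suc k) = ?h k" by (auto simp: override_on_def fun_eq_iff less_Suc_eq)
    with k show False by simp
  qed
  with k that show thesis by blast
qed

text \<open>A fair coin at \<open>k\<close> and point masses elsewhere.\<close>

lemma edge_distribution:
  assumes "k < m" "z \<in> cube m"
  obtains \<mu> where "\<mu> \<in> prod_dists m" "set_pmf \<mu> \<subseteq> {z, z(k := \<not> z k)}"
    "pmf \<mu> z = 1/2" "pmf \<mu> (z(k := \<not> z k)) = 1/2"
proof
  let ?p = "\<lambda>i. if i = k then pmf_of_set UNIV else return_pmf (z i)"
  let ?\<mu> = "Pi_pmf {..<m} False ?p"
  show "?\<mu> \<in> prod_dists m" unfolding prod_dists_eq_Pi_pmf by blast
  show "set_pmf ?\<mu> \<subseteq> {z, z(k := \<not> z k)}"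
  proof
    fix x assume "x \<in> set_pmf ?\<mu>"
    then have "x i = z i" if "i \<noteq> k" for i
      using that assms by (cases "i < m") (auto simp: set_Pi_pmf PiE_dflt_def cube_def split: if_splits)
    then have "x = z(k := x k)" by (simp add: fun_eq_iff)
    then show "x \<in> {z, z(k := \<not> z k)}" by (cases "x k = z k") auto
  qed
  have "pmf ?\<mu> (z(k := b)) = 1/2" for b
  proof -
    have "pmf ?\<mu> (z(k := b)) = (\<Prod>i<m. pmf (?p i) ((z(k := b)) i))"
      using assms by (intro pmf_Pi') (auto simp: cube_def)
    also have "\<dots> = (\<Prod>i<m. if i = k then 1/2 else 1)"
      by (intro prod.cong) auto
    finally show ?thesis using assms by simp
  qed
  from this[of "z k"] this[of "\<not> z k"]
  show "pmf ?\<mu> z = 1/2" "pmf ?\<mu> (z(k := \<not> z k)) = 1/2" by simp_all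
qed

text \<open>On the uniform distribution over the flipping edge, a tree that confuses
  \<open>x\<close> and \<open>y\<close> has error exactly 1/2, so half the probability of confusion
  is at most \<epsilon>.\<close>

lemma computes_prod_imp_sabotages:
  assumes R: "computes_prod \<epsilon> m g R"
  shows "sabotages (2 * \<epsilon>) m g R"
proof -
  have "measure_pmf.prob R {T. leaf_of T x = leaf_of T y} \<le> 2 * \<epsilon>"
    if xy: "x \<in> cube m" "y \<in> cube m" "\<not> g x" "g y" for x y
  proof -
    obtain k where k: "k < m" "x k \<noteq> y k"
      "\<not> g (override_on x y {..<k})" "g (override_on x y {..<Suc k})"
      using adjacent_hybrid xy by blast
    define z where "z = override_on x y {..<k}"
    define z' where "z' = z(k := \<not> z k)"
    have z': "z' = override_on x y {..<Suc k}"
      using k by (auto simp: z'_def z_def override_on_def fun_eq_iff)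
    have cube: "z \<in> cube m" "z' \<in> cube m"
      using xy by (auto simp: z_def z' override_on_def cube_def)
    obtain \<mu> where \<mu>: "\<mu> \<in> prod_dists m" "set_pmf \<mu> \<subseteq> {z, z'}" "pmf \<mu> z = 1/2" "pmf \<mu> z' = 1/2"
      using edge_distribution[OF k(1) cube(1)] unfolding z'_def by blast
    let ?e = "\<lambda>T. measure_pmf.expectation (map_pmf (leaf_of T) \<mu>) (leaf_error m g \<mu> T)"
    have err: "?e T = 1/2" if T: "leaf_of T x = leaf_of T y" for T
    proof -
      \<comment> \<open>Each bit of \<open>z\<close> and \<open>z'\<close> comes from
        \<open>x\<close> or \<open>y\<close>, and these agree on the queried coordinates.\<close>
      have leaf: "leaf_of T z = leaf_of T x" "leaf_of T z' = leaf_of T x"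
        using T unfolding z_def z' by (auto simp: leaf_of_eq_iff[of T x] override_on_def intro!: sym[of "leaf_of T x"])
      let ?S = "subcube m T (leaf_of T x)"
      have S: "set_pmf \<mu> \<subseteq> ?S"
        using \<mu>(2) leaf cube by (auto simp: subcube_def)
      have ne: "set_pmf \<mu> \<inter> ?S \<noteq> {}"
        using S set_pmf_not_empty[of \<mu>] by auto
      have "measure_pmf.prob \<mu> ?S = 1"
        using S by (auto simp: measure_pmf.prob_eq_1 AE_measure_pmf_iff)
      then have cond: "cond_pmf \<mu> ?S = \<mu>"
        using S by (intro pmf_eqI) (auto simp: pmf_cond[OF ne] set_pmf_iff)
      have "measure_pmf.prob \<mu> {u. \<not> g u} = measure_pmf.prob \<mu> {z}"
        "measure_pmf.prob \<mu> {u. g u} = measure_pmf.prob \<mu> {z'}"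
        using \<mu>(2) k(3,4)
        by (auto intro!: measure_pmf.finite_measure_eq_AE simp: AE_measure_pmf_iff z_def[symmetric] z'[symmetric])
      then have "leaf_error m g \<mu> T (leaf_of T x) = 1/2"
        by (simp add: leaf_error_def cond measure_pmf_single \<mu>)
      moreover have "?e T = measure_pmf.expectation \<mu> (\<lambda>_. leaf_error m g \<mu> T (leaf_of T x))"
        unfolding integral_map_pmf using \<mu>(2) leaf
        by (intro integral_cong_AE) (auto simp: AE_measure_pmf_iff)
      ultimately show ?thesis by simp
    qed
    have bounds: "0 \<le> ?e T" "?e T \<le> 1" for T
      by (auto intro!: integral_nonneg_AE measure_pmf.integral_le_const
          measure_pmf.integrable_const_bound[where B = 1] simp: leaf_error_bounds)
    have "measure_pmf.prob R {T. leaf_of T x = leaf_of T y} / 2 =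
        measure_pmf.expectation R (\<lambda>T. indicator {T. leaf_of T x = leaf_of T y} T / 2)"
      by simp
    also have "\<dots> \<le> measure_pmf.expectation R ?e"
      by (rule expectation_mono_pmf[where B = 1]) (auto simp: indicator_def err bounds simp del: integral_map_pmf)
    also have "\<dots> \<le> \<epsilon>"
      using R \<mu>(1) unfolding computes_prod_def by blast
    finally show ?thesis by simp
  qed
  then show ?thesis by (simp add: sabotages_iff)
qed

section \<open>From sabotage to product distributions\<close>

context
  fixes m :: nat and p :: "nat \<Rightarrow> bool pmf" and \<mu> :: "(nat \<Rightarrow> bool) pmf"
  defines "\<mu> \<equiv> Pi_pmf {..<m} False p"
begin

lemma set_pmf_product_subset_cube: "set_pmf \<mu> \<subseteq> cube m"
  using set_Pi_pmf_subset[of "{..<m}" False p] by (auto simp: \<mu>_def cube_def not_less)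

text \<open>Under a product distribution, reaching the leaf constrains only the queried coordinates,
  hence is independent of the resampled input, which depends only on the others.\<close>

lemma cond_subcube_eq_resample:
  assumes x: "x \<in> set_pmf \<mu>"
  shows "cond_pmf \<mu> (subcube m T (leaf_of T x)) = map_pmf (\<lambda>z. override_on x z (- queried T x)) \<mu>"
proof (rule pmf_eqI)
  fix y
  let ?S = "subcube m T (leaf_of T x)" and ?h = "\<lambda>z. override_on x z (- queried T x)"
  have "x \<in> ?S" using x set_pmf_product_subset_cube by (auto simp: subcube_def)
  then have ne: "set_pmf \<mu> \<inter> ?S \<noteq> {}" using x by auto
  have pos: "measure_pmf.prob \<mu> ?S > 0"
    using x \<open>x \<in> ?S\<close> by (auto intro!: measure_pmf_posI)
  have S: "measure_pmf.prob \<mu> ?S = measure_pmf.prob \<mu> {z. \<forall>i\<in>queried T x. x i = z i}"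
    using set_pmf_product_subset_cube
    by (intro measure_pmf.finite_measure_eq_AE) (auto simp: AE_measure_pmf_iff subcube_def leaf_of_eq_iff[of T x, symmetric])
  have "measure_pmf.prob \<mu> ?S * measure_pmf.prob \<mu> {z. ?h z = y} =
      measure_pmf.prob \<mu> {z. (\<forall>i\<in>queried T x. x i = z i) \<and> ?h z = y}"
    unfolding S unfolding \<mu>_def
  proof (rule Pi_pmf_indep)
    fix a b :: "nat \<Rightarrow> bool"
    assume "\<And>i. i \<notin> queried T x \<Longrightarrow> a i = b i"
    then have "?h a = ?h b" by (auto simp: override_on_def fun_eq_iff)
    then show "(?h a = y) = (?h b = y)" by simp
  qed auto
  \<comment> \<open>If \<open>z\<close> agrees with \<open>x\<close> on the queried coordinates,
    resampling returns \<open>z\<close> itself, a point of the leaf.\<close>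
  also have "\<dots> = measure_pmf.prob \<mu> (if y \<in> ?S then {y} else {})"
  proof (rule measure_pmf.finite_measure_eq_AE)
    have "((\<forall>i\<in>queried T x. x i = z i) \<and> ?h z = y) \<longleftrightarrow> z \<in> (if y \<in> ?S then {y} else {})"
      if "z \<in> set_pmf \<mu>" for z
    proof -
      have "z \<in> cube m" using that set_pmf_product_subset_cube by auto
      moreover have "?h z = z" if "\<forall>i\<in>queried T x. x i = z i"
        using that by (auto simp: override_on_def fun_eq_iff)
      ultimately show ?thesis
        by (auto simp: subcube_def leaf_of_eq_iff[of T x, symmetric] eq_commute[of "leaf_of T x"])
    qed
    then show "AE z in measure_pmf \<mu>. z \<in> {z. (\<forall>i\<in>queried T x. x i = z i) \<and> ?h z = y} \<longleftrightarrow>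
        z \<in> (if y \<in> ?S then {y} else {})"
      by (simp add: AE_measure_pmf_iff)
  qed simp_all
  also have "\<dots> = (if y \<in> ?S then pmf \<mu> y else 0)"
    by (simp add: measure_pmf_single)
  finally have "measure_pmf.prob \<mu> {z. ?h z = y} = (if y \<in> ?S then pmf \<mu> y / measure_pmf.prob \<mu> ?S else 0)"
    using pos by (auto simp: field_simps split: if_splits)
  then show "pmf (cond_pmf \<mu> ?S) y = pmf (map_pmf ?h \<mu>) y"
    by (simp add: pmf_cond[OF ne] pmf_map vimage_def)
qed

text \<open>The minimum is at most the conditional probability of the value other than
  \<open>g x\<close>.\<close>

lemma expected_leaf_error_le:
  "measure_pmf.expectation (map_pmf (leaf_of T) \<mu>) (leaf_error m g \<mu> T) \<le>
   measure_pmf.prob (pair_pmf \<mu> \<mu>) {(x, z). g x \<noteq> g (override_on x z (- queried T x))}"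
proof -
  have le: "leaf_error m g \<mu> T (leaf_of T x) \<le>
      measure_pmf.prob \<mu> {z. g x \<noteq> g (override_on x z (- queried T x))}" if "x \<in> set_pmf \<mu>" for x
    unfolding leaf_error_def cond_subcube_eq_resample[OF that] by (cases "g x") (auto simp: vimage_def)
  show ?thesis
    unfolding prob_pair_pmf integral_map_pmf
    by (rule expectation_mono_pmf[where B = 1]) (use le in \<open>auto simp: leaf_error_bounds\<close>)
qed

section \<open>Random colourings of the coordinates\<close>

context
  fixes K :: nat and \<gamma> :: "(nat \<Rightarrow> nat) pmf"
  assumes K: "0 < K"
  defines "\<gamma> \<equiv> Pi_pmf {..<m} 0 (\<lambda>_. pmf_of_set {..<K})"
begin

text \<open>Coordinates from \<open>m\<close> on have the default colour 0, which is also below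
  \<open>K\<close>.\<close>

lemma set_pmf_colouring: "c \<in> set_pmf \<gamma> \<Longrightarrow> c i < K"
  using K by (cases "i < m") (auto simp: \<gamma>_def set_Pi_pmf PiE_dflt_def set_pmf_of_set lessThan_empty_iff)

text \<open>By Bernoulli's inequality the power of 1 - 1/K with exponent \<open>card Q\<close> is at
  least 1 - \<open>card Q\<close>/K, hence at least 1/2.\<close>

lemma prob_colour_avoids:
  assumes Q: "Q \<subseteq> {..<m}" "2 * card Q \<le> K" and j: "j < K"
  shows "measure_pmf.prob \<gamma> {c. \<forall>i\<in>Q. c i \<noteq> j} \<ge> 1/2"
proof -
  have ne: "{..<K} \<noteq> {}" using K by auto
  have one: "measure_pmf.prob (pmf_of_set {..<K}) (- {j}) = 1 + - (1 / K)"
  proof -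
    have "card ({..<K} \<inter> - {j}) = K - 1"
      using j by (simp add: Diff_eq[symmetric])
    then show ?thesis
      using K ne by (simp add: measure_pmf_of_set of_nat_diff field_simps)
  qed
  have "1/2 \<le> 1 + real (card Q) * - (1 / K)"
    using Q(2) K by (simp add: field_simps)
  also have "\<dots> \<le> (1 + - (1 / K)) ^ card Q"
    using K by (intro Bernoulli_inequality) auto
  also have "\<dots> = (\<Prod>i<m. if i \<in> Q then 1 + - (1 / K) else 1)"
    using Q(1) by (simp add: prod.inter_restrict[symmetric] Int_absorb1)
  also have "\<dots> = (\<Prod>i<m. measure_pmf.prob (pmf_of_set {..<K}) (if i \<in> Q then - {j} else UNIV))"
    by (intro prod.cong) (simp_all add: one)
  also have "\<dots> = measure_pmf.prob \<gamma> (Pi {..<m} (\<lambda>i. if i \<in> Q then - {j} else UNIV))"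
    unfolding \<gamma>_def by (rule measure_Pi_pmf_Pi[symmetric]) simp
  also have "Pi {..<m} (\<lambda>i. if i \<in> Q then - {j} else UNIV) = {c. \<forall>i\<in>Q. c i \<noteq> j}"
    using Q(1) by (auto simp: Pi_def split: if_splits)
  finally show ?thesis .
qed

text \<open>
  The pair of consecutive hybrids is an input and its copy with one colour class resampled: exchange
  \<open>x\<close> and \<open>z\<close> on the unqueried coordinates of colour less than \<open>j\<close>, which does not affect the
  branch followed by \<open>x\<close>.
\<close>

lemma prob_consecutive_hybrids:
  "measure_pmf.prob (pair_pmf (pair_pmf \<mu> \<mu>) \<gamma>)
     {((x, z), c). g (override_on x z {i. i \<notin> queried T x \<and> c i < j}) \<noteq>
                   g (override_on x z {i. i \<notin> queried T x \<and> c i < Suc j})} =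
   measure_pmf.prob (pair_pmf (pair_pmf \<mu> \<mu>) \<gamma>)
     {((x, z), c). g x \<noteq> g (override_on x z {i. i \<notin> queried T x \<and> c i = j})}"
proof -
  let ?M = "pair_pmf (pair_pmf \<mu> \<mu>) \<gamma>"
  define U where "U = (\<lambda>x (c :: nat \<Rightarrow> nat). {i. i \<notin> queried T x \<and> c i < j})"
  define F where "F = (\<lambda>((x, z), c). ((override_on x z (U x c), override_on z x (U x c)), c))"
  have q: "queried T (override_on x z (U x c)) = queried T x" for x z c
    by (rule queried_eq[symmetric]) (auto simp: leaf_of_eq_iff override_on_def U_def)
  have U: "U (override_on x z (U x c)) c = U x c" for x z c
    using q[of x z c] by (simp add: U_def)
  have "F (F w) = w" for w
    by (cases w) (auto simp: F_def U, auto simp: override_on_def fun_eq_iff)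
  moreover have "pmf ?M (F w) = pmf ?M w" for w
    by (cases w) (auto simp: F_def pmf_pair \<mu>_def pmf_Pi_override_swap)
  ultimately have F: "map_pmf F ?M = ?M"
    by (rule map_pmf_involution)
  \<comment> \<open>Colour \<open>j\<close> is not exchanged, so resampling it still brings in
    values of \<open>z\<close>; with the exchanged smaller colours this is the next hybrid.\<close>
  have step: "override_on (override_on x z (U x c)) (override_on z x (U x c)) {i. i \<notin> queried T x \<and> c i = j} =
      override_on x z {i. i \<notin> queried T x \<and> c i < Suc j}" for x z c
    by (auto simp: override_on_def fun_eq_iff U_def)
  have "measure_pmf.prob ?M {((x, z), c). g x \<noteq> g (override_on x z {i. i \<notin> queried T x \<and> c i = j})} =
      measure_pmf.prob (map_pmf F ?M) {((x, z), c). g x \<noteq> g (override_on x z {i. i \<notin> queried T x \<and> c i = j})}"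
    unfolding F ..
  also have "\<dots> = measure_pmf.prob ?M {((x, z), c). g (override_on x z (U x c)) \<noteq>
      g (override_on x z {i. i \<notin> queried T x \<and> c i < Suc j})}"
    unfolding measure_map_pmf
    by (rule arg_cong[where f = "measure_pmf.prob ?M"]) (auto simp: F_def q step)
  finally show ?thesis by (simp add: U_def)
qed

text \<open>
  Whether colour \<open>j\<close> hits the queried coordinates is independent of how it is used on the others.
  If it misses them, then resampling the whole colour class is the same as resampling its unqueried
  part; the former does not depend on \<open>T\<close>, so the sabotage guarantee applies to it.
\<close>

lemma prob_resample_le:
  assumes T: "vars T \<subseteq> {..<m}" "2 * depth T \<le> K" and j: "j < K"
  shows "measure_pmf.prob (pair_pmf (pair_pmf \<mu> \<mu>) \<gamma>)
     {((x, z), c). g x \<noteq> g (override_on x z {i. i \<notin> queried T x \<and> c i = j})} \<le>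
   2 * measure_pmf.prob (pair_pmf (pair_pmf \<mu> \<mu>) \<gamma>)
     {((x, z), c). g x \<noteq> g (override_on x z {i. c i = j}) \<and>
                   leaf_of T x = leaf_of T (override_on x z {i. c i = j})}"
proof -
  have le: "measure_pmf.prob \<gamma> {c. g x \<noteq> g (override_on x z {i. i \<notin> queried T x \<and> c i = j})} \<le>
      2 * measure_pmf.prob \<gamma> {c. g x \<noteq> g (override_on x z {i. c i = j}) \<and>
                   leaf_of T x = leaf_of T (override_on x z {i. c i = j})}" (is "?a \<le> 2 * ?b") for x z
  proof -
    let ?E = "\<lambda>c. \<forall>i\<in>queried T x. c i \<noteq> j"
      and ?P = "\<lambda>c. g x \<noteq> g (override_on x z {i. i \<notin> queried T x \<and> c i = j})"
    have "measure_pmf.prob \<gamma> {c. ?E c} \<ge> 1/2"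
      using queried_subset_vars[of T x] card_queried_le_depth[of T x] T j
      by (intro prob_colour_avoids) auto
    then have "1/2 * ?a \<le> measure_pmf.prob \<gamma> {c. ?E c} * ?a"
      by (intro mult_right_mono) auto
    also have "\<dots> = measure_pmf.prob \<gamma> {c. ?E c \<and> ?P c}"
      unfolding \<gamma>_def
    proof (rule Pi_pmf_indep)
      fix a b :: "nat \<Rightarrow> nat"
      assume "\<And>i. i \<notin> queried T x \<Longrightarrow> a i = b i"
      then have "{i. i \<notin> queried T x \<and> a i = j} = {i. i \<notin> queried T x \<and> b i = j}" by auto
      then show "?P a = ?P b" by simp
    qed auto
    also have "\<dots> \<le> ?b"
    proof (rule measure_pmf.finite_measure_mono)
      have "{i. i \<notin> queried T x \<and> c i = j} = {i. c i = j}"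
        "leaf_of T x = leaf_of T (override_on x z {i. c i = j})" if "?E c" for c
        using that by (auto simp: leaf_of_eq_iff override_on_def)
      then show "{c. ?E c \<and> ?P c} \<subseteq> {c. g x \<noteq> g (override_on x z {i. c i = j}) \<and>
                   leaf_of T x = leaf_of T (override_on x z {i. c i = j})}"
        by auto
    qed simp
    finally show ?thesis by simp
  qed
  have "measure_pmf.expectation (pair_pmf \<mu> \<mu>)
      (\<lambda>w. measure_pmf.prob \<gamma> {c. (w, c) \<in> {((x, z), c). g x \<noteq> g (override_on x z {i. i \<notin> queried T x \<and> c i = j})}}) \<le>
    measure_pmf.expectation (pair_pmf \<mu> \<mu>)
      (\<lambda>w. 2 * measure_pmf.prob \<gamma> {c. (w, c) \<in> {((x, z), c). g x \<noteq> g (override_on x z {i. c i = j}) \<and>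
                   leaf_of T x = leaf_of T (override_on x z {i. c i = j})}})"
    by (rule expectation_mono_pmf[where B = 2]) (auto intro!: le)
  then show ?thesis
    by (simp only: prob_pair_pmf[of "pair_pmf \<mu> \<mu>"] integral_mult_right_zero)
qed

text \<open>If \<open>g\<close> changes between \<open>x\<close> and the fully resampled input, it
  changes between two of the \<open>K + 1\<close> hybrids that are consecutive; a union bound
  charges each step with \<open>prob_resample_le\<close>.\<close>

lemma expected_leaf_error_le_resample:
  assumes T: "vars T \<subseteq> {..<m}" "2 * depth T \<le> K"
  shows "measure_pmf.expectation (map_pmf (leaf_of T) \<mu>) (leaf_error m g \<mu> T) \<le>
   2 * (\<Sum>j<K. measure_pmf.prob (pair_pmf (pair_pmf \<mu> \<mu>) \<gamma>)
     {((x, z), c). g x \<noteq> g (override_on x z {i. c i = j}) \<and>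
                   leaf_of T x = leaf_of T (override_on x z {i. c i = j})})"
proof -
  let ?M = "pair_pmf (pair_pmf \<mu> \<mu>) \<gamma>"
  define H where "H = (\<lambda>j (x :: nat \<Rightarrow> bool) z (c :: nat \<Rightarrow> nat). override_on x z {i. i \<notin> queried T x \<and> c i < j})"
  let ?D = "\<lambda>j. {((x, z), c). g (H j x z c) \<noteq> g (H (Suc j) x z c)}"
  \<comment> \<open>The colouring enters as an independent third component.\<close>
  have "measure_pmf.prob (pair_pmf \<mu> \<mu>) {(x, z). g x \<noteq> g (override_on x z (- queried T x))} =
      measure_pmf.prob (map_pmf fst ?M) {(x, z). g x \<noteq> g (override_on x z (- queried T x))}"
    by (simp only: map_fst_pair_pmf)
  also have "\<dots> = measure_pmf.prob ?M {((x, z), c). g x \<noteq> g (override_on x z (- queried T x))}"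
    unfolding measure_map_pmf by (rule arg_cong[where f = "measure_pmf.prob ?M"]) auto
  also have "\<dots> \<le> measure_pmf.prob ?M (\<Union>j<K. ?D j)"
  proof (rule measure_pmf.finite_measure_mono_AE)
    have "\<exists>j<K. g (H j x z c) \<noteq> g (H (Suc j) x z c)"
      if c: "c \<in> set_pmf \<gamma>" and g: "g x \<noteq> g (override_on x z (- queried T x))" for x z c
    proof (rule ccontr)
      assume neg: "\<not> ?thesis"
      have "g (H j x z c) = g (H 0 x z c)" if "j \<le> K" for j
        using that by (induction j) (use neg in auto)
      moreover have "H 0 x z c = x" by (simp add: H_def)
      moreover have "H K x z c = override_on x z (- queried T x)"
        using set_pmf_colouring[OF c] by (auto simp: H_def override_on_def fun_eq_iff)
      ultimately show False using g by (metis order_refl)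
    qed
    then show "AE w in measure_pmf ?M. w \<in> {((x, z), c). g x \<noteq> g (override_on x z (- queried T x))} \<longrightarrow>
        w \<in> (\<Union>j<K. ?D j)"
      by (simp add: AE_measure_pmf_iff Bex_def)
  qed simp
  also have "\<dots> \<le> (\<Sum>j<K. measure_pmf.prob ?M (?D j))"
    by (rule measure_pmf.finite_measure_subadditive_finite) auto
  also have "\<dots> \<le> (\<Sum>j<K. 2 * measure_pmf.prob ?M
     {((x, z), c). g x \<noteq> g (override_on x z {i. c i = j}) \<and>
                   leaf_of T x = leaf_of T (override_on x z {i. c i = j})})"
    unfolding H_def prob_consecutive_hybrids by (intro sum_mono prob_resample_le T) simp
  finally show ?thesis
    using expected_leaf_error_le[of T g] by (simp only: sum_distrib_left)
qed

text \<open>The pair compared in each summand is drawn independently of the tree. Averaging over the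
  tree first, the sabotage guarantee bounds each of the \<open>K\<close> summands by
  \<delta>.\<close>

lemma expected_error_le:
  assumes R: "R \<in> rdtrees m D" "sabotages \<delta> m g R" and D: "2 * D \<le> K" and \<delta>: "0 \<le> \<delta>"
  shows "measure_pmf.expectation R
           (\<lambda>T. measure_pmf.expectation (map_pmf (leaf_of T) \<mu>) (leaf_error m g \<mu> T)) \<le> 2 * real K * \<delta>"
proof -
  let ?M = "pair_pmf (pair_pmf \<mu> \<mu>) \<gamma>"
  let ?B = "\<lambda>j T. {((x, z), c). g x \<noteq> g (override_on x z {i. c i = j}) \<and>
                   leaf_of T x = leaf_of T (override_on x z {i. c i = j})}"
  have each: "measure_pmf.expectation R (\<lambda>T. measure_pmf.prob ?M (?B j T)) \<le> \<delta>" for j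
  proof -
    let ?E = "{(T, w). w \<in> ?B j T}"
    have "measure_pmf.expectation R (\<lambda>T. measure_pmf.prob ?M (?B j T)) = measure_pmf.prob (pair_pmf R ?M) ?E"
      by (simp add: prob_pair_pmf[of R])
    also have "\<dots> = measure_pmf.prob (pair_pmf ?M R) {(w, T). w \<in> ?B j T}"
      by (subst pair_commute_pmf, unfold measure_map_pmf)
        (rule arg_cong[where f = "measure_pmf.prob (pair_pmf ?M R)"], auto)
    also have "\<dots> = measure_pmf.expectation ?M (\<lambda>w. measure_pmf.prob R {T. w \<in> ?B j T})"
      by (simp add: prob_pair_pmf[of ?M])
    also have "\<dots> \<le> measure_pmf.expectation ?M (\<lambda>_. \<delta>)"
    proof (rule expectation_mono_pmf[where B = \<delta>])
      fix w assume w: "w \<in> set_pmf ?M"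
      obtain x z c where xzc: "w = ((x, z), c)" by (metis surj_pair)
      let ?y = "override_on x z {i. c i = j}"
      have "x \<in> cube m" "?y \<in> cube m"
        using w set_pmf_product_subset_cube by (auto simp: xzc cube_def override_on_def)
      then have "measure_pmf.prob R {T. w \<in> ?B j T} \<le> \<delta>"
        \<comment> \<open>If \<open>g\<close> agrees on the pair, the event is empty and
          \<open>0 \<le> \<delta>\<close> suffices.\<close>
        using sabotagesD[OF R(2), of x ?y] \<delta> by (cases "g x = g ?y") (simp_all add: xzc)
      then show "0 \<le> measure_pmf.prob R {T. w \<in> ?B j T} \<and>
          measure_pmf.prob R {T. w \<in> ?B j T} \<le> \<delta> \<and> \<delta> \<le> \<delta>"
        by simp
    qed
    finally show ?thesis by simp
  qed
  have "measure_pmf.expectation R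
           (\<lambda>T. measure_pmf.expectation (map_pmf (leaf_of T) \<mu>) (leaf_error m g \<mu> T)) \<le>
      measure_pmf.expectation R (\<lambda>T. 2 * (\<Sum>j<K. measure_pmf.prob ?M (?B j T)))"
  proof (rule expectation_mono_pmf[where B = "2 * real K"])
    fix T assume "T \<in> set_pmf R"
    then have T: "vars T \<subseteq> {..<m}" "2 * depth T \<le> K"
      using R(1) D by (fastforce simp: rdtrees_def)+
    have "(\<Sum>j<K. measure_pmf.prob ?M (?B j T)) \<le> (\<Sum>j<K. 1)"
      by (intro sum_mono) simp
    then show "0 \<le> measure_pmf.expectation (map_pmf (leaf_of T) \<mu>) (leaf_error m g \<mu> T) \<and>
      measure_pmf.expectation (map_pmf (leaf_of T) \<mu>) (leaf_error m g \<mu> T) \<le>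
        2 * (\<Sum>j<K. measure_pmf.prob ?M (?B j T)) \<and>
      2 * (\<Sum>j<K. measure_pmf.prob ?M (?B j T)) \<le> 2 * real K"
      using expected_leaf_error_le_resample[OF T, of g]
      by (intro conjI integral_nonneg_AE) (auto simp: leaf_error_bounds)
  qed
  also have "\<dots> = 2 * (\<Sum>j<K. measure_pmf.expectation R (\<lambda>T. measure_pmf.prob ?M (?B j T)))"
    by (subst integral_mult_right_zero, subst Bochner_Integration.integral_sum)
      (auto intro!: measure_pmf.integrable_const_bound[where B = 1])
  also have "\<dots> \<le> (2::real) * (\<Sum>j<K. \<delta>)"
    by (intro mult_left_mono sum_mono each) auto
  finally show ?thesis by simp
qed

end

end

section \<open>The bounds between the two complexity measures\<close>

lemma sabotages_imp_computes_prod: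
  assumes "R \<in> rdtrees m D" "sabotages \<delta> m g R" "0 \<le> \<delta>"
    and "0 < K" "2 * D \<le> K" "2 * real K * \<delta> \<le> \<epsilon>"
  shows "computes_prod \<epsilon> m g R"
  using order_trans[OF expected_error_le[OF assms(4,1,2,5,3)] assms(6)]
  unfolding computes_prod_def prod_dists_eq_Pi_pmf by blast

lemma RS_le_Rprod: "RS m g \<le> 3 * Rprod m g"
proof -
  have "\<exists>R\<in>rdtrees m (Rprod m g). computes_prod (1/3) m g R"
    unfolding Rprod_def Rprod_err_def
    by (rule LeastI_ex) (use full_tree_rdtrees[of m] full_tree_computes_prod[of "1/3" m g] in
      \<open>auto intro!: exI[of _ m] bexI\<close>)
  then obtain R where R: "R \<in> rdtrees m (Rprod m g)" "computes_prod (1/3) m g R" by blast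
  \<comment> \<open>Three repetitions lower the failure probability from 2/3 to 8/27, which is below
    1/3.\<close>
  have "sabotages ((2 * (1/3)) ^ 3) m g (repeat_tree R 3)"
    by (intro sabotages_repeat_tree computes_prod_imp_sabotages R)
  then have "sabotages (1/3) m g (repeat_tree R 3)"
    by (rule sabotages_mono) (simp add: power3_eq_cube)
  then show ?thesis
    unfolding RS_def RS_err_def using repeat_tree_rdtrees[OF R(1)] by (blast intro: Least_le)
qed

text \<open>From \<open>j \<ge> 2\<close> to \<open>j + 1\<close> the left side grows by the factor
  2(j+1)/j, at most 3. This absorbs the factor \<open>k\<close> by which repetition deepens the
  tree.\<close>

lemma mult_two_power_le_three_power: "k * 2 ^ k \<le> (3::nat) ^ k"
proof (induction k rule: less_induct)
  case (less k)
  show ?case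
  proof (cases "k < 3")
    case True
    then have "k \<in> {0, 1, 2}" by auto
    then show ?thesis by auto
  next
    case False
    then obtain j where j: "k = Suc j" "j \<ge> 2" by (cases k) auto
    have "k * 2 ^ k = (2 * j + 2) * 2 ^ j" by (simp add: j)
    also have "\<dots> \<le> (3 * j) * 2 ^ j" using j by (intro mult_right_mono) auto
    also have "\<dots> \<le> 3 ^ k" using less.IH[of j] by (simp add: j)
    finally show ?thesis .
  qed
qed

text \<open>With \<open>d = max 1 (RS m g)\<close>, the choice of \<open>2 * (k * d)\<close> colours
  and \<delta> = \<open>(1/3) ^ k\<close> gives error at most \<open>4 * k * d * (1/3) ^ k\<close>;
  demanding at most 1/3 explains the 12. The maximum with 1 keeps the number of colours positive
  when \<open>RS m g = 0\<close>.\<close>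

lemma Rprod_le_RS:
  assumes "12 * max 1 (RS m g) \<le> 2 ^ k"
  shows "Rprod m g \<le> k * RS m g"
proof -
  let ?d = "max 1 (RS m g)"
  have "\<exists>R\<in>rdtrees m (RS m g). sabotages (1/3) m g R"
    unfolding RS_def RS_err_def
    by (rule LeastI_ex) (use full_tree_rdtrees[of m] full_tree_sabotages[of "1/3" m g] in
      \<open>auto intro!: exI[of _ m] bexI\<close>)
  then obtain R where R: "R \<in> rdtrees m (RS m g)" "sabotages (1/3) m g R" by blast
  have "k > 0" using assms by (cases k) auto
  have "k * (12 * ?d) \<le> k * 2 ^ k" using assms by simp
  also have "\<dots> \<le> 3 ^ k" by (rule mult_two_power_le_three_power)
  finally have "12 * (k * ?d) \<le> 3 ^ k" by (simp add: mult_ac)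
  then have "real (12 * (k * ?d)) \<le> real (3 ^ k)" by (rule of_nat_mono)
  then have small: "2 * real (2 * (k * ?d)) * (1/3) ^ k \<le> 1/3"
    by (simp add: power_divide field_simps)
  have "computes_prod (1/3) m g (repeat_tree R k)"
  proof (rule sabotages_imp_computes_prod[OF _ _ _ _ _ small])
    show "repeat_tree R k \<in> rdtrees m (k * RS m g)" by (rule repeat_tree_rdtrees[OF R(1)])
    show "sabotages ((1/3) ^ k) m g (repeat_tree R k)" by (rule sabotages_repeat_tree[OF R(2)])
  qed (use \<open>k > 0\<close> in auto)
  then show ?thesis
    unfolding Rprod_def Rprod_err_def using repeat_tree_rdtrees[OF R(1)] by (blast intro: Least_le)
qed

lemma Rprod_div_log_le_RS:
  assumes "2 \<le> Rprod m g"
  shows "1/8 * (real (Rprod m g) / log 2 (real (Rprod m g))) \<le> real (RS m g)"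
proof -
  let ?P = "Rprod m g" and ?d = "RS m g"
  define L where "L = log 2 (real ?P)"
  have L: "1 \<le> L" using assms by (simp add: L_def)
  \<comment> \<open>The first bound turns a logarithm of \<open>RS\<close> into one of
    \<open>Rprod\<close>; 4 instead of 3 makes the additive loss exactly 2.\<close>
  have dP: "real (max 1 ?d) \<le> 4 * real ?P" using RS_le_Rprod[of m g] assms by linarith
  \<comment> \<open>The summand 4 covers the factor 12, since \<open>12 \<le> 2 ^ 4\<close>.\<close>
  define k where "k = 4 + nat \<lceil>log 2 (real (max 1 ?d))\<rceil>"
  have nn: "0 \<le> log 2 (real (max 1 ?d))" by simp
  have "real (max 1 ?d) = 2 powr log 2 (real (max 1 ?d))" by simp
  also have "\<dots> \<le> 2 powr real (nat \<lceil>log 2 (real (max 1 ?d))\<rceil>)"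
    by (intro powr_mono) linarith+
  also have "\<dots> = 2 ^ nat \<lceil>log 2 (real (max 1 ?d))\<rceil>"
    by (rule powr_realpow) simp
  finally have "max 1 ?d \<le> 2 ^ nat \<lceil>log 2 (real (max 1 ?d))\<rceil>"
    by (metis of_nat_le_iff of_nat_numeral of_nat_power)
  then have "12 * max 1 ?d \<le> 2 ^ 4 * 2 ^ nat \<lceil>log 2 (real (max 1 ?d))\<rceil>"
    by (intro mult_mono) auto
  then have "12 * max 1 ?d \<le> 2 ^ k" unfolding k_def power_add .
  then have "?P \<le> k * ?d" by (rule Rprod_le_RS)
  then have "real ?P \<le> real k * real ?d" by (metis of_nat_le_iff of_nat_mult)
  \<comment> \<open>Rounding up costs at most 1, so \<open>k \<le> 4 + (2 + L) + 1\<close>, and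
    \<open>7 + L \<le> 8 * L\<close> because \<open>1 \<le> L\<close>.\<close>
  also have "real k \<le> 8 * L"
  proof -
    have "log 2 (real (max 1 ?d)) \<le> log 2 (4 * real ?P)" using dP by (intro log_mono) auto
    also have "\<dots> = 2 + L"
    proof -
      have "log 2 4 = (2::real)" using log_pow_cancel[of 2 2] by simp
      then show ?thesis using assms by (simp add: log_mult L_def)
    qed
    finally show ?thesis using L nn unfolding k_def by linarith
  qed
  finally have "real ?P \<le> 8 * L * real ?d" by (simp add: mult_right_mono)
  then show ?thesis using L by (simp add: L_def[symmetric] field_simps)
qed

theorem theorem2:
  shows "(\<exists>C>0::real. \<forall>(m::nat) (g::(nat \<Rightarrow> bool) \<Rightarrow> bool).
            real (RS m g) \<le> C * real (Rprod m g))
       \<and> (\<exists>c>0::real. \<forall>(m::nat) (g::(nat \<Rightarrow> bool) \<Rightarrow> bool). Rprod m g \<ge> 2 \<longrightarrow>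
            real (RS m g) \<ge> c * (real (Rprod m g) / log 2 (real (Rprod m g))))"
proof
  have "real (RS m g) \<le> 3 * real (Rprod m g)" for m g
    using RS_le_Rprod[of m g] by linarith
  then show "\<exists>C>0::real. \<forall>m g. real (RS m g) \<le> C * real (Rprod m g)"
    by (intro exI[of _ 3]) simp
  show "\<exists>c>0::real. \<forall>m g. Rprod m g \<ge> 2 \<longrightarrow>
      real (RS m g) \<ge> c * (real (Rprod m g) / log 2 (real (Rprod m g)))"
    using Rprod_div_log_le_RS by (intro exI[of _ "1/8"]) simp
qed

end
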